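(* Let $(X,\gamma)$ be a generalized Minkowski space with unit ball $B(0,1)=\{x\in X:\gamma(x)\le 1\}$. If all exposed faces of $B(0,1)$ are polytopes, then for every finite non-empty set $P=\{p_1,\ldots,p_n\}\subseteq X$ the Fermat--Torricelli locus $\mathrm{ft}(P)$ is a convex polytope (possibly with empty interior). In particular, this conclusion holds if $X$ is two-dimensional or if $B(0,1)$ is a polytope.
   Context: $X$ is a finite-dimensional real vector space. A gauge on $X$ is a function $\gamma:X\to[0,+\infty)$ such that $\gamma(x)=0$ implies $x=0$; $\gamma(\lambda x)=\lambda\gamma(x)$ for all $x\in X$, $\lambda\ge 0$; and $\gamma(x+y)\le\gamma(x)+\gamma(y)$ for all $x,y\in X$ (no symmetry is assumed). The pair $(X,\gamma)$ is called a generalized Minkowski space. For a finite set $P=\{p_1,\ldots,p_n\}$ of $n\ge1$ distinct points, $\mathrm{ft}(P)$ is the set of all minimizers over $X$ of $x\mapsto\sum_{i=1}^n\gamma(p_i-x)$. $X^\ast$ is the space of linear functionals on $X$. An exposed face of a compact convex set $K\subseteq X$ is the intersection of $K$ with one of its supporting hyperplanes $\{y\in X:\phi(y)=\sup_{x\in K}\phi(x)\}$, where $\phi\in X^\ast\setminus\{0\}$. A polytope is the convex hull of finitely many points. *)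

theory Defs
  imports "HOL-Analysis.Analysis"
begin

definition finite_dimensional :: "'a::real_vector itself \<Rightarrow> bool" where
  "finite_dimensional _ \<longleftrightarrow> (\<exists>B::'a set. finite B \<and> span B = UNIV)"

text \<open>Named to avoid a clash with the Henstock--Kurzweil \<open>gauge\<close> of the library.
  No symmetry is assumed: scaling is by nonnegative reals only.\<close>

definition minkowski_gauge :: "('a::real_vector \<Rightarrow> real) \<Rightarrow> bool" where
  "minkowski_gauge \<gamma> \<longleftrightarrow>
     (\<forall>x. 0 \<le> \<gamma> x) \<and>
     (\<forall>x. \<gamma> x = 0 \<longrightarrow> x = 0) \<and>
     (\<forall>x l. 0 \<le> l \<longrightarrow> \<gamma> (l *\<^sub>R x) = l * \<gamma> x) \<and>
     (\<forall>x y. \<gamma> (x + y) \<le> \<gamma> x + \<gamma> y)"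

definition unit_ball :: "('a::real_vector \<Rightarrow> real) \<Rightarrow> 'a set" where
  "unit_ball \<gamma> = {x. \<gamma> x \<le> 1}"

definition ft :: "('a::real_vector \<Rightarrow> real) \<Rightarrow> 'a set \<Rightarrow> 'a set" where
  "ft \<gamma> P = {x. \<forall>y. (\<Sum>p\<in>P. \<gamma> (p - x)) \<le> (\<Sum>p\<in>P. \<gamma> (p - y))}"

text \<open>Not the library's \<open>exposed_face_of\<close>: that notion also admits the zero functional,
  so that the set itself always counts as one of its exposed faces.
  The definition is meant for nonempty \<open>K\<close> on which every linear functional is bounded above
  (such as compact sets), so that the supremum is a genuine one.\<close>

definition exposed_face :: "'a::real_vector set \<Rightarrow> 'a set \<Rightarrow> bool" where
  "exposed_face F K \<longleftrightarrow>
     (\<exists>\<phi> :: 'a \<Rightarrow> real. linear \<phi> \<and> \<phi> \<noteq> (\<lambda>_. 0) \<and>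
        F = K \<inter> {y. \<phi> y = (SUP x\<in>K. \<phi> x)})"

end

theory Submission
  imports Defs
begin

text \<open>
  The empty set is a polytope, so suppose that minimizers exist.
  Let \<open>m\<close> be the minimal value of \<open>\<lambda>x. \<Sum>p\<in>P. \<gamma> (p - x)\<close> and choose a minimizer \<open>x0\<close> in the
  relative interior of the convex set \<open>ft \<gamma> P\<close>. By Hahn--Banach there is for each \<open>p\<close> a linear
  functional \<open>a p\<close> that lies below \<open>\<gamma>\<close> and agrees with it at \<open>p - x0\<close>
  (\<open>gauge_supporting_functional\<close>). A sum of convex functions is constant on a segment only if each
  summand is affine there. So every \<open>\<lambda>x. \<gamma> (p - x)\<close> is affine on each segment of minimizers that
  has \<open>x0\<close> in its interior; it lies above the affine function \<open>\<lambda>x. a p \<bullet> (p - x)\<close> and touches it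
  at \<open>x0\<close>, so the two agree on all of \<open>ft \<gamma> P\<close>
  (\<open>supporting_functional_tight_on_ft\<close>).

  Hence \<open>ft \<gamma> P\<close> lies in \<open>D = (\<Inter>p\<in>P. {x. \<gamma> (p - x) = a p \<bullet> (p - x) \<and> \<gamma> (p - x) \<le> m})\<close>.
  On \<open>D\<close> the objective is affine, so \<open>ft \<gamma> P\<close> is cut out of \<open>D\<close> by the single half-space
  on which this affine function is at most \<open>m\<close>. Each set in the intersection is the reflected and
  translated truncation of the cone on which \<open>\<gamma>\<close> equals a functional. Unless it is just \<open>{0}\<close>, such a cone
  is spanned by an exposed face of the unit ball, and its truncation at height \<open>m\<close> is the convex hull of \<open>0\<close>
  and a multiple of that face, so it is a polytope (\<open>polytope_support_cone_truncation\<close>).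

  The two special cases follow because an exposed face is the intersection of the ball with a
  hyperplane: in the plane this is a compact convex subset of a line, and for a polytope it is again
  a polytope.

  This argument takes place in a Euclidean space. A real vector space of finite positive dimension is
  linearly isomorphic to \<open>real ^ 'i\<close>, where \<open>'i\<close> is a type whose elements represent the
  members of a basis, and all the notions involved are carried along by a linear bijection.
\<close>

section \<open>Gauges\<close>

lemma gauge_nonneg: "minkowski_gauge \<gamma> \<Longrightarrow> 0 \<le> \<gamma> x"
  and gauge_eq_0D: "minkowski_gauge \<gamma> \<Longrightarrow> \<gamma> x = 0 \<Longrightarrow> x = 0"
  and gauge_scale: "minkowski_gauge \<gamma> \<Longrightarrow> 0 \<le> l \<Longrightarrow> \<gamma> (l *\<^sub>R x) = l * \<gamma> x"
  and gauge_triangle: "minkowski_gauge \<gamma> \<Longrightarrow> \<gamma> (x + y) \<le> \<gamma> x + \<gamma> y"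
  by (auto simp: minkowski_gauge_def)

lemma gauge_0: "minkowski_gauge \<gamma> \<Longrightarrow> \<gamma> 0 = 0"
  using gauge_scale[of \<gamma> 0 0] by simp

lemma gauge_pos: "minkowski_gauge \<gamma> \<Longrightarrow> x \<noteq> 0 \<Longrightarrow> 0 < \<gamma> x"
  by (metis gauge_nonneg gauge_eq_0D order_le_less)

lemma gauge_convex_combination:
  assumes "minkowski_gauge \<gamma>" "0 \<le> u" "0 \<le> v"
  shows "\<gamma> (u *\<^sub>R x + v *\<^sub>R y) \<le> u * \<gamma> x + v * \<gamma> y"
  using gauge_triangle[OF assms(1), of "u *\<^sub>R x" "v *\<^sub>R y"] assms by (simp add: gauge_scale)

lemma convex_gauge_less:
  assumes "minkowski_gauge \<gamma>"
  shows "convex {x. \<gamma> x < c}"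
proof (rule convexI)
  fix x y and u v :: real
  assume "x \<in> {x. \<gamma> x < c}" "y \<in> {x. \<gamma> x < c}" "0 \<le> u" "0 \<le> v" "u + v = 1"
  then show "u *\<^sub>R x + v *\<^sub>R y \<in> {x. \<gamma> x < c}"
    using gauge_convex_combination[OF assms, of u v x y] convex_bound_lt[of "\<gamma> x" c "\<gamma> y" u v]
    by simp
qed

lemma convex_unit_ball:
  assumes "minkowski_gauge \<gamma>"
  shows "convex (unit_ball \<gamma>)"
  unfolding unit_ball_def
proof (rule convexI)
  fix x y and u v :: real
  assume "x \<in> {x. \<gamma> x \<le> 1}" "y \<in> {x. \<gamma> x \<le> 1}" "0 \<le> u" "0 \<le> v" "u + v = 1"
  then show "u *\<^sub>R x + v *\<^sub>R y \<in> {x. \<gamma> x \<le> 1}"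
    using gauge_convex_combination[OF assms, of u v x y] convex_bound_le[of "\<gamma> x" 1 "\<gamma> y" u v]
    by simp
qed

lemma gauge_comp_linear_inj:
  assumes "minkowski_gauge \<gamma>" "linear L" "inj L"
  shows "minkowski_gauge (\<gamma> \<circ> L)"
  unfolding minkowski_gauge_def o_def
  using assms by (auto simp: gauge_nonneg gauge_scale gauge_triangle linear_add linear_cmul
      dest!: gauge_eq_0D simp: linear_injective_0)

text \<open>On the Euclidean unit sphere the gauge attains a positive minimum, which bounds the Euclidean
  norm by a multiple of the gauge.\<close>

lemma compact_unit_ball:
  fixes \<gamma> :: "'a::euclidean_space \<Rightarrow> real"
  assumes "minkowski_gauge \<gamma>"
  shows "compact (unit_ball \<gamma>)"
proof -
  have "convex_on UNIV \<gamma>"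
    by (rule convex_onI) (use gauge_convex_combination[OF assms] in auto)
  then have cont: "continuous_on UNIV \<gamma>" by (intro convex_on_continuous) auto
  have "closed {x. \<gamma> x \<le> 1}"
    using cont by (intro closed_Collect_le continuous_on_const)
  moreover have "bounded {x. \<gamma> x \<le> 1}"
  proof -
    have "sphere (0::'a) 1 \<noteq> {}" by simp
    then obtain u :: 'a where "u \<in> sphere 0 1" "\<And>y. y \<in> sphere 0 1 \<Longrightarrow> \<gamma> u \<le> \<gamma> y"
      using continuous_attains_inf[of "sphere (0::'a) 1" \<gamma>] continuous_on_subset[OF cont]
        compact_sphere by blast
    then have u: "norm u = 1" "\<And>y. norm y = 1 \<Longrightarrow> \<gamma> u \<le> \<gamma> y" by auto
    have pos: "0 < \<gamma> u" using u(1) by (intro gauge_pos[OF assms]) auto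
    have "norm x \<le> 1 / \<gamma> u" if "\<gamma> x \<le> 1" for x
    proof (cases "x = 0")
      case False
      have "\<gamma> u \<le> \<gamma> ((1 / norm x) *\<^sub>R x)" using False by (intro u(2)) simp
      also have "\<dots> = \<gamma> x / norm x" using gauge_scale[OF assms, of "1 / norm x" x] by simp
      finally have "norm x * \<gamma> u \<le> \<gamma> x" using False by (simp add: field_simps)
      with that pos show ?thesis by (simp add: field_simps)
    qed (use pos in simp)
    then show ?thesis by (auto simp: bounded_iff)
  qed
  ultimately show ?thesis by (simp add: unit_ball_def compact_eq_bounded_closed)
qed

text \<open>A hyperplane separates \<open>y\<close> from the convex set of points of smaller gauge. Its normal
  vector, rescaled to have the right value at \<open>y\<close>, lies below \<open>\<gamma>\<close> by homogeneity.\<close>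

lemma gauge_supporting_functional:
  fixes \<gamma> :: "'a::euclidean_space \<Rightarrow> real"
  assumes g: "minkowski_gauge \<gamma>"
  obtains a where "\<And>x. a \<bullet> x \<le> \<gamma> x" "a \<bullet> y = \<gamma> y"
proof (cases "y = 0")
  case True
  then show ?thesis using that[of 0] by (simp add: gauge_nonneg[OF g] gauge_0[OF g])
next
  case False
  define U where "U = {x. \<gamma> x < \<gamma> y}"
  have gy: "0 < \<gamma> y" using gauge_pos[OF g False] .
  have "convex U" unfolding U_def by (rule convex_gauge_less[OF g])
  moreover have "0 \<in> U" using gy by (simp add: U_def gauge_0[OF g])
  moreover have "U \<inter> {y} = {}" by (auto simp: U_def)
  ultimately obtain a b where ab: "a \<noteq> 0" "\<forall>x\<in>U. a \<bullet> x \<le> b" "b \<le> a \<bullet> y"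
    using separating_hyperplane_sets[of U "{y}"] by auto
  have U_le: "a \<bullet> x \<le> a \<bullet> y" if "\<gamma> x < \<gamma> y" for x
    using ab(2,3) that by (force simp: U_def)
  have ga: "0 < \<gamma> a" using gauge_pos[OF g ab(1)] .
  \<comment> \<open>A short multiple of \<open>a\<close> lies in \<open>U\<close>, which forces \<open>a \<bullet> y\<close> to be positive.\<close>
  have "\<gamma> ((\<gamma> y / (2 * \<gamma> a)) *\<^sub>R a) < \<gamma> y"
    using gy ga by (simp add: gauge_scale[OF g])
  from U_le[OF this] have "(\<gamma> y / (2 * \<gamma> a)) * (a \<bullet> a) \<le> a \<bullet> y" by simp
  moreover have "0 < (\<gamma> y / (2 * \<gamma> a)) * (a \<bullet> a)" using gy ga ab(1) by simp
  ultimately have ay: "0 < a \<bullet> y" by linarith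
  show ?thesis
  proof (rule that[of "(\<gamma> y / (a \<bullet> y)) *\<^sub>R a"])
    fix x
    show "((\<gamma> y / (a \<bullet> y)) *\<^sub>R a) \<bullet> x \<le> \<gamma> x"
    \<comment> \<open>The strict bound \<open>t\<close> is needed because the separation concerns strictly smaller gauges.\<close>
    proof (rule dense_ge)
      fix t assume t: "\<gamma> x < t"
      then have "0 < t" using gauge_nonneg[OF g, of x] by linarith
      have "\<gamma> ((\<gamma> y / t) *\<^sub>R x) < \<gamma> y"
        using gy t \<open>0 < t\<close> by (simp add: gauge_scale[OF g] field_simps)
      from U_le[OF this] show "((\<gamma> y / (a \<bullet> y)) *\<^sub>R a) \<bullet> x \<le> t"
        using ay \<open>0 < t\<close> by (simp add: field_simps)
    qed
  qed (use ay in simp)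
qed

section \<open>Polytopes cut from cones over exposed faces\<close>

lemma exposed_face_unit_ball_inner:
  fixes a :: "'a::real_inner"
  assumes "\<And>x. a \<bullet> x \<le> \<gamma> x" "\<gamma> z = 1" "a \<bullet> z = 1"
  shows "exposed_face {x. \<gamma> x \<le> 1 \<and> a \<bullet> x = 1} (unit_ball \<gamma>)"
proof -
  have "(SUP x\<in>unit_ball \<gamma>. a \<bullet> x) = 1"
    by (rule cSup_eq_maximum) (use assms in \<open>force simp: unit_ball_def intro: order_trans\<close>)+
  moreover have "linear (\<lambda>x. a \<bullet> x)" by (simp add: linear_iff inner_add_right)
  moreover have "(\<lambda>x. a \<bullet> x) \<noteq> (\<lambda>_. 0)" using assms(3) by (metis zero_neq_one)
  ultimately show ?thesis
    unfolding exposed_face_def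
    by (intro exI[of _ "\<lambda>x. a \<bullet> x"]) (auto simp: unit_ball_def)
qed

text \<open>Unless the cone \<open>{x. \<gamma> x = a \<bullet> x}\<close> is trivial, its points of gauge \<open>1\<close> form an exposed
  face, and cutting the cone at height \<open>R\<close> gives the pyramid with apex \<open>0\<close> over the
  \<open>R\<close>-fold multiple of that face. The truncation keeps the set bounded; the whole cone would
  only be a polyhedron.\<close>

lemma polytope_support_cone_truncation:
  fixes \<gamma> :: "'a::real_inner \<Rightarrow> real"
  assumes g: "minkowski_gauge \<gamma>"
    and faces: "\<And>F. exposed_face F (unit_ball \<gamma>) \<Longrightarrow> polytope F"
    and le: "\<And>x. a \<bullet> x \<le> \<gamma> x" and R: "0 \<le> R"
  shows "polytope {x. \<gamma> x = a \<bullet> x \<and> \<gamma> x \<le> R}" (is "polytope ?S")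
proof (cases "\<exists>z. z \<noteq> 0 \<and> \<gamma> z = a \<bullet> z")
  case False
  then have "?S = {0}" using R by (auto simp: gauge_0[OF g])
  then show ?thesis by (simp add: polytope_sing)
next
  case True
  define F where "F = {x. \<gamma> x \<le> 1 \<and> a \<bullet> x = 1}"
  have F_iff: "x \<in> F \<longleftrightarrow> \<gamma> x = 1 \<and> a \<bullet> x = 1" for x
    using le[of x] by (auto simp: F_def)
  have unit: "(1 / \<gamma> x) *\<^sub>R x \<in> F" if "x \<noteq> 0" "\<gamma> x = a \<bullet> x" for x
    using gauge_pos[OF g that(1)] that(2) by (simp add: F_iff gauge_scale[OF g])
  obtain z where z: "z \<in> F" using True unit by blast
  then have "polytope F"
    unfolding F_def using le
    by (intro faces exposed_face_unit_ball_inner[where z = z]) (use z in \<open>auto simp: F_iff\<close>)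
  then obtain V where V: "finite V" "F = convex hull V" by (auto simp: polytope_def)
  then have "V \<noteq> {}" using z by auto
  have hull: "convex hull ((\<lambda>x. R *\<^sub>R x) ` V) = (\<lambda>x. R *\<^sub>R x) ` F"
    by (simp add: V(2) convex_hull_scaling)
  have "?S = convex hull (insert 0 ((\<lambda>x. R *\<^sub>R x) ` V))"
  proof (intro set_eqI iffI)
    fix x assume x: "x \<in> ?S"
    show "x \<in> convex hull (insert 0 ((\<lambda>x. R *\<^sub>R x) ` V))"
    proof (cases "x = 0")
      case False
      have gx: "0 < \<gamma> x" "\<gamma> x \<le> R" using gauge_pos[OF g False] x by auto
      then have "x = (1 - \<gamma> x / R) *\<^sub>R 0 + (\<gamma> x / R) *\<^sub>R (R *\<^sub>R ((1 / \<gamma> x) *\<^sub>R x))" by simp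
      moreover have "R *\<^sub>R ((1 / \<gamma> x) *\<^sub>R x) \<in> (\<lambda>x. R *\<^sub>R x) ` F" using unit False x by blast
      moreover have "0 \<le> \<gamma> x / R" "\<gamma> x / R \<le> 1" using gx by auto
      ultimately have "x \<in> {(1 - u) *\<^sub>R 0 + u *\<^sub>R w |w u. 0 \<le> u \<and> u \<le> 1 \<and> w \<in> (\<lambda>x. R *\<^sub>R x) ` F}"
        by blast
      then show ?thesis
        using \<open>V \<noteq> {}\<close> unfolding convex_hull_insert_alt hull by simp
    qed (simp add: hull_inc)
  next
    fix x assume "x \<in> convex hull (insert 0 ((\<lambda>x. R *\<^sub>R x) ` V))"
    then have "x \<in> {(1 - u) *\<^sub>R 0 + u *\<^sub>R w |w u. 0 \<le> u \<and> u \<le> 1 \<and> w \<in> (\<lambda>x. R *\<^sub>R x) ` F}"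
      using \<open>V \<noteq> {}\<close> unfolding convex_hull_insert_alt hull by simp
    then obtain u w where u: "0 \<le> u" "u \<le> 1" "w \<in> F" "x = (u * R) *\<^sub>R w" by force
    then have "\<gamma> x = u * R" "a \<bullet> x = u * R" using R by (auto simp: F_iff gauge_scale[OF g])
    moreover have "u * R \<le> R" using u R by (simp add: mult_left_le_one_le)
    ultimately show "x \<in> ?S" by simp
  qed
  then show ?thesis using V(1) by (simp add: polytope_convex_hull)
qed

section \<open>Fermat--Torricelli loci in Euclidean space\<close>

lemma convex_ft:
  assumes g: "minkowski_gauge \<gamma>"
  shows "convex (ft \<gamma> P)"
proof -
  have "convex {x. (\<Sum>p\<in>P. \<gamma> (p - x)) \<le> c}" for c
  proof (rule convexI)
    fix x y and u v :: real
    assume x: "x \<in> {x. (\<Sum>p\<in>P. \<gamma> (p - x)) \<le> c}" and y: "y \<in> {x. (\<Sum>p\<in>P. \<gamma> (p - x)) \<le> c}"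
      and uv: "0 \<le> u" "0 \<le> v" "u + v = 1"
    have "\<gamma> (p - (u *\<^sub>R x + v *\<^sub>R y)) \<le> u * \<gamma> (p - x) + v * \<gamma> (p - y)" for p
    proof -
      have "p - (u *\<^sub>R x + v *\<^sub>R y) = (u + v) *\<^sub>R p - (u *\<^sub>R x + v *\<^sub>R y)" using uv by simp
      also have "\<dots> = u *\<^sub>R (p - x) + v *\<^sub>R (p - y)" by (simp add: algebra_simps)
      finally show ?thesis using gauge_convex_combination[OF g] uv by simp
    qed
    then have "(\<Sum>p\<in>P. \<gamma> (p - (u *\<^sub>R x + v *\<^sub>R y))) \<le> (\<Sum>p\<in>P. u * \<gamma> (p - x) + v * \<gamma> (p - y))"
      by (rule sum_mono)
    also have "\<dots> = u * (\<Sum>p\<in>P. \<gamma> (p - x)) + v * (\<Sum>p\<in>P. \<gamma> (p - y))"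
      by (simp add: sum.distrib sum_distrib_left)
    also have "\<dots> \<le> c" using x y uv by (intro convex_bound_le) auto
    finally show "u *\<^sub>R x + v *\<^sub>R y \<in> {x. (\<Sum>p\<in>P. \<gamma> (p - x)) \<le> c}" by simp
  qed
  moreover have "ft \<gamma> P = (\<Inter>y. {x. (\<Sum>p\<in>P. \<gamma> (p - x)) \<le> (\<Sum>p\<in>P. \<gamma> (p - y))})"
    by (auto simp: ft_def)
  ultimately show ?thesis by (simp add: convex_INT)
qed

lemma eq_if_le_and_sum_ge:
  fixes f h :: "'i \<Rightarrow> real"
  assumes "finite I" "\<And>i. i \<in> I \<Longrightarrow> f i \<le> h i" "sum h I \<le> sum f I" "i \<in> I"
  shows "f i = h i"
proof (rule ccontr)
  assume "f i \<noteq> h i"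
  then have "sum f I < sum h I"
    using assms by (intro sum_strict_mono_ex1) (auto simp: order_less_le)
  with assms(3) show False by simp
qed

text \<open>Since \<open>x0\<close> is a relative interior point, the segment from \<open>x\<close> to \<open>x0\<close> can be prolonged
  to a minimizer \<open>x'\<close> beyond \<open>x0\<close>. Convexity is tight at \<open>x0\<close> for the sum, hence for the
  summand of \<open>p\<close>. A strict inequality between \<open>a\<close> and \<open>\<gamma>\<close> at \<open>p - x\<close> would then have to
  be compensated at \<open>p - x'\<close>, where \<open>a\<close> does not exceed \<open>\<gamma>\<close> either.\<close>

lemma supporting_functional_tight_on_ft:
  fixes \<gamma> :: "'a::euclidean_space \<Rightarrow> real"
  assumes g: "minkowski_gauge \<gamma>" and P: "finite P" "p \<in> P"
    and x0: "x0 \<in> rel_interior (ft \<gamma> P)"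
    and le: "\<And>z. a \<bullet> z \<le> \<gamma> z" and eq: "a \<bullet> (p - x0) = \<gamma> (p - x0)"
    and x: "x \<in> ft \<gamma> P"
  shows "\<gamma> (p - x) = a \<bullet> (p - x)"
proof -
  obtain e where e: "e > 1" "(1 - e) *\<^sub>R x + e *\<^sub>R x0 \<in> ft \<gamma> P"
    using convex_rel_interior_iff[OF convex_ft[OF g]] x x0 by blast
  define x' where "x' = (1 - e) *\<^sub>R x + e *\<^sub>R x0"
  define u where "u = (e - 1) / e"
  have u: "0 < u" "0 < 1 - u" using e(1) by (auto simp: u_def field_simps)
  have x0_eq: "q - x0 = u *\<^sub>R (q - x) + (1 - u) *\<^sub>R (q - x')" for q
  proof -
    have "e *\<^sub>R (q - x0) = (e - 1) *\<^sub>R (q - x) + (q - x')"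
      by (simp add: x'_def algebra_simps)
    then have "(1 / e) *\<^sub>R (e *\<^sub>R (q - x0)) = (1 / e) *\<^sub>R ((e - 1) *\<^sub>R (q - x) + (q - x'))"
      by simp
    moreover have "1 - u = 1 / e" using e(1) by (simp add: u_def field_simps)
    ultimately show ?thesis using e(1) by (simp add: u_def scaleR_add_right)
  qed
  have min: "(\<Sum>q\<in>P. \<gamma> (q - x)) \<le> (\<Sum>q\<in>P. \<gamma> (q - x0))" "(\<Sum>q\<in>P. \<gamma> (q - x')) \<le> (\<Sum>q\<in>P. \<gamma> (q - x0))"
    using x e(2) by (auto simp: ft_def x'_def)
  \<comment> \<open>Each summand is convex and their sum takes the same value at \<open>x\<close>, \<open>x0\<close> and \<open>x'\<close>.\<close>
  have "\<gamma> (p - x0) = u * \<gamma> (p - x) + (1 - u) * \<gamma> (p - x')"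
  proof (rule eq_if_le_and_sum_ge[OF P(1) _ _ P(2)])
    show "\<gamma> (q - x0) \<le> u * \<gamma> (q - x) + (1 - u) * \<gamma> (q - x')" for q
      unfolding x0_eq[of q] using u by (intro gauge_convex_combination[OF g]) auto
    have "(\<Sum>q\<in>P. u * \<gamma> (q - x) + (1 - u) * \<gamma> (q - x'))
        = u * (\<Sum>q\<in>P. \<gamma> (q - x)) + (1 - u) * (\<Sum>q\<in>P. \<gamma> (q - x'))"
      by (simp add: sum.distrib sum_distrib_left)
    also have "\<dots> \<le> (\<Sum>q\<in>P. \<gamma> (q - x0))"
      using min u by (intro convex_bound_le) auto
    finally show "(\<Sum>q\<in>P. u * \<gamma> (q - x) + (1 - u) * \<gamma> (q - x')) \<le> (\<Sum>q\<in>P. \<gamma> (q - x0))" .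
  qed
  moreover have "a \<bullet> (p - x0) = u * (a \<bullet> (p - x)) + (1 - u) * (a \<bullet> (p - x'))"
    unfolding x0_eq[of p] inner_add_right inner_scaleR_right by simp
  moreover have "(1 - u) * (a \<bullet> (p - x')) \<le> (1 - u) * \<gamma> (p - x')"
    using le u by (intro mult_left_mono) auto
  ultimately have "u * \<gamma> (p - x) \<le> u * (a \<bullet> (p - x))" using eq by linarith
  then have "\<gamma> (p - x) \<le> a \<bullet> (p - x)" using u by simp
  then show ?thesis using le[of "p - x"] by simp
qed

lemma polytope_INT:
  fixes S :: "'i \<Rightarrow> 'a::euclidean_space set"
  assumes "finite I" "I \<noteq> {}" "\<And>i. i \<in> I \<Longrightarrow> polytope (S i)"
  shows "polytope (\<Inter>i\<in>I. S i)"
  using assms by (induction I rule: finite_ne_induct) (auto intro: polytope_Int)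

theorem polytope_ft_euclidean:
  fixes \<gamma> :: "'a::euclidean_space \<Rightarrow> real"
  assumes g: "minkowski_gauge \<gamma>"
    and faces: "\<And>F. exposed_face F (unit_ball \<gamma>) \<Longrightarrow> polytope F"
    and P: "finite P" "P \<noteq> {}"
  shows "polytope (ft \<gamma> P)"
proof (cases "ft \<gamma> P = {}")
  case True
  then show ?thesis by (simp add: polytope_empty)
next
  case False
  then obtain x0 where x0: "x0 \<in> rel_interior (ft \<gamma> P)"
    using rel_interior_eq_empty[OF convex_ft[OF g]] by blast
  then have x0_ft: "x0 \<in> ft \<gamma> P" using rel_interior_subset by blast
  define m where "m = (\<Sum>p\<in>P. \<gamma> (p - x0))"
  have m: "0 \<le> m" by (simp add: m_def sum_nonneg gauge_nonneg[OF g])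
  have ft_iff: "x \<in> ft \<gamma> P \<longleftrightarrow> (\<Sum>p\<in>P. \<gamma> (p - x)) \<le> m" for x
    using x0_ft unfolding ft_def m_def mem_Collect_eq by (meson order_trans)
  have "\<exists>a. (\<forall>x. a \<bullet> x \<le> \<gamma> x) \<and> a \<bullet> (p - x0) = \<gamma> (p - x0)" for p
    using gauge_supporting_functional[OF g] by metis
  then obtain a where a: "\<And>p x. a p \<bullet> x \<le> \<gamma> x" "\<And>p. a p \<bullet> (p - x0) = \<gamma> (p - x0)"
    by metis
  define D where "D = (\<lambda>p. (\<lambda>z. p - z) ` {z. \<gamma> z = a p \<bullet> z \<and> \<gamma> z \<le> m})"
  have D_iff: "x \<in> D p \<longleftrightarrow> \<gamma> (p - x) = a p \<bullet> (p - x) \<and> \<gamma> (p - x) \<le> m" for x p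
    unfolding D_def by (auto intro!: image_eqI[of _ _ "p - x"])
  have "polytope (D p)" for p
  proof -
    have "polytope ((\<lambda>z. p + z) ` uminus ` {z. \<gamma> z = a p \<bullet> z \<and> \<gamma> z \<le> m})"
      unfolding polytope_translation_eq
      by (intro polytope_linear_image linear_uminus polytope_support_cone_truncation g faces a m)
    then show ?thesis by (simp add: D_def image_image)
  qed
  then have "polytope (\<Inter>p\<in>P. D p)" using P by (intro polytope_INT) auto
  moreover have "ft \<gamma> P = (\<Inter>p\<in>P. D p) \<inter> {x. (- (\<Sum>p\<in>P. a p)) \<bullet> x \<le> m - (\<Sum>p\<in>P. a p \<bullet> p)}"
  proof -
    have sum_eq: "(\<Sum>p\<in>P. \<gamma> (p - x)) = (\<Sum>p\<in>P. a p \<bullet> p) - (\<Sum>p\<in>P. a p) \<bullet> x"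
      if "x \<in> (\<Inter>p\<in>P. D p)" for x
    proof -
      have "(\<Sum>p\<in>P. \<gamma> (p - x)) = (\<Sum>p\<in>P. a p \<bullet> (p - x))"
        using that by (intro sum.cong) (auto simp: D_iff)
      then show ?thesis by (simp add: inner_diff_right sum_subtractf inner_sum_left)
    qed
    \<comment> \<open>Each summand is at most the whole sum, which is why truncating at height \<open>m\<close> loses nothing.\<close>
    have "ft \<gamma> P \<subseteq> (\<Inter>p\<in>P. D p)"
    proof (intro subsetI INT_I)
      fix x p assume x: "x \<in> ft \<gamma> P" and p: "p \<in> P"
      have "\<gamma> (p - x) \<le> (\<Sum>p\<in>P. \<gamma> (p - x))"
        using P(1) p by (intro member_le_sum) (auto simp: gauge_nonneg[OF g])
      also have "\<dots> \<le> m" using x ft_iff by simp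
      finally show "x \<in> D p"
        using supporting_functional_tight_on_ft[OF g P(1) p x0 a(1) a(2) x] by (simp add: D_iff)
    qed
    then show ?thesis using sum_eq by (fastforce simp: ft_iff)
  qed
  ultimately show ?thesis
    by (simp only: polytope_Int_polyhedron polyhedron_halfspace_le)
qed

lemma exposed_face_inner:
  fixes K :: "'a::euclidean_space set"
  assumes "exposed_face F K"
  obtains a b where "a \<noteq> 0" "F = K \<inter> {x. a \<bullet> x = b}"
proof -
  obtain \<phi> :: "'a \<Rightarrow> real" where \<phi>: "linear \<phi>" "\<phi> \<noteq> (\<lambda>_. 0)"
      "F = K \<inter> {y. \<phi> y = (SUP x\<in>K. \<phi> x)}"
    using assms by (auto simp: exposed_face_def)
  have eq: "\<phi> x = adjoint \<phi> 1 \<bullet> x" for x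
    using adjoint_works[OF \<phi>(1), of x 1] by (simp add: inner_commute)
  then have "adjoint \<phi> 1 \<noteq> 0" using \<phi>(2) by auto
  with \<phi>(3) eq show ?thesis using that by simp
qed

lemma polytope_exposed_face_of_polytope:
  fixes K :: "'a::euclidean_space set"
  assumes "polytope K" "exposed_face F K"
  shows "polytope F"
  by (metis assms exposed_face_inner polytope_Int_polyhedron polyhedron_hyperplane)

lemma polytope_exposed_face_plane:
  fixes K :: "'a::euclidean_space set"
  assumes "DIM('a) = 2" "compact K" "convex K" "exposed_face F K"
  shows "polytope F"
proof (cases "F = {}")
  case False
  obtain a b where ab: "a \<noteq> 0" "F = K \<inter> {x. a \<bullet> x = b}"
    using exposed_face_inner[OF assms(4)] .
  have "aff_dim F \<le> aff_dim {x. a \<bullet> x = b}" using ab by (intro aff_dim_subset) auto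
  then have "collinear F" using ab(1) assms(1) by (simp add: collinear_aff_dim aff_dim_hyperplane)
  moreover have "compact F" "convex F"
    using ab assms by (auto intro: compact_Int_closed closed_hyperplane convex_Int convex_hyperplane)
  ultimately obtain c d where "F = closed_segment c d"
    using compact_convex_collinear_segment False by blast
  then show ?thesis by (simp add: segment_convex_hull polytope_convex_hull)
qed (simp add: polytope_empty)

section \<open>Coordinates\<close>

text \<open>The set has to be nonempty and finite for every real vector space, so that it can serve as the
  carrier of a finite type; it is a basis when the space has finite positive dimension.\<close>

definition coordinate_basis :: "'a::real_vector set" where
  "coordinate_basis = (SOME B. finite B \<and> B \<noteq> {} \<and>
     (finite_dimensional TYPE('a) \<and> (\<exists>x::'a. x \<noteq> 0) \<longrightarrow> independent B \<and> span B = UNIV))"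

lemma coordinate_basis_exists:
  "\<exists>B::'a::real_vector set. finite B \<and> B \<noteq> {} \<and>
     (finite_dimensional TYPE('a) \<and> (\<exists>x::'a. x \<noteq> 0) \<longrightarrow> independent B \<and> span B = UNIV)"
proof (cases "finite_dimensional TYPE('a) \<and> (\<exists>x::'a. x \<noteq> 0)")
  case True
  then obtain C :: "'a set" where C: "finite C" "span C = UNIV"
    by (auto simp: finite_dimensional_def)
  obtain B where B: "B \<subseteq> C" "independent B" "C \<subseteq> span B"
    using maximal_independent_subset[of C] by blast
  then have "span B = UNIV" using C(2) by (metis span_minimal subspace_span top.extremum_uniqueI)
  moreover from this have "B \<noteq> {}" using True by (metis span_empty UNIV_I singletonD)
  ultimately show ?thesis using B C by (meson finite_subset)
next
  case False
  then show ?thesis by (intro exI[of _ "{0}"]) auto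
qed

lemma coordinate_basis:
  shows finite_coordinate_basis: "finite (coordinate_basis :: 'a::real_vector set)"
    and coordinate_basis_nonempty: "(coordinate_basis :: 'a set) \<noteq> {}"
    and "finite_dimensional TYPE('a) \<Longrightarrow> \<exists>x::'a. x \<noteq> 0 \<Longrightarrow> independent (coordinate_basis :: 'a set)"
    and "finite_dimensional TYPE('a) \<Longrightarrow> \<exists>x::'a. x \<noteq> 0 \<Longrightarrow> span (coordinate_basis :: 'a set) = UNIV"
  using someI_ex[OF coordinate_basis_exists[where 'a = 'a]]
  unfolding coordinate_basis_def[symmetric] by blast+

text \<open>The dimension of \<open>real ^ 'i\<close> is a property of the type \<open>'i\<close>. An index type that depends on
  \<open>'a\<close> yields a coordinate space of exactly the dimension of \<open>'a\<close>.\<close>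

typedef (overloaded) ('a::real_vector) basis_index = "coordinate_basis :: 'a set"
  using coordinate_basis_nonempty by blast

instance basis_index :: (real_vector) finite
proof
  have "(UNIV :: 'a basis_index set) = Abs_basis_index ` coordinate_basis"
    by (simp add: type_definition.Abs_image[OF type_definition_basis_index])
  then show "finite (UNIV :: 'a basis_index set)" by (metis finite_imageI finite_coordinate_basis)
qed

definition from_coordinates :: "real ^ 'a basis_index \<Rightarrow> 'a::real_vector" where
  "from_coordinates v = (\<Sum>i\<in>UNIV. v $ i *\<^sub>R Rep_basis_index i)"

lemma linear_from_coordinates: "linear from_coordinates"
  by (rule linearI)
     (simp_all add: from_coordinates_def scaleR_add_left sum.distrib scaleR_right.sum)

lemma bij_betw_Rep_basis_index: "bij_betw Rep_basis_index UNIV coordinate_basis"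
  using type_definition.Rep_range[OF type_definition_basis_index]
  by (auto simp: bij_betw_def inj_on_def Rep_basis_index_inject)

lemma from_coordinates_eq:
  "from_coordinates v = (\<Sum>b\<in>coordinate_basis. v $ Abs_basis_index b *\<^sub>R b)"
  unfolding from_coordinates_def
  by (rule sum.reindex_bij_betw[OF bij_betw_Rep_basis_index, symmetric, THEN trans, symmetric])
     (simp_all add: Rep_basis_index_inverse)

lemma bij_from_coordinates:
  assumes "finite_dimensional TYPE('a::real_vector)" "\<exists>x::'a. x \<noteq> 0"
  shows "bij (from_coordinates :: _ \<Rightarrow> 'a)"
proof (rule bijI)
  show "inj (from_coordinates :: _ \<Rightarrow> 'a)"
    unfolding linear_injective_0[OF linear_from_coordinates]
  proof (intro allI impI)
    fix v :: "real ^ 'a basis_index" assume "from_coordinates v = 0"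
    then have "v $ Abs_basis_index b = 0" if "b \<in> coordinate_basis" for b
      using independentD[OF coordinate_basis(3)[OF assms] finite_coordinate_basis subset_refl _ that,
          of "\<lambda>b. v $ Abs_basis_index b"]
      by (simp add: from_coordinates_eq)
    then show "v = 0" by (metis Rep_basis_index Rep_basis_index_inverse vec_eq_iff zero_index)
  qed
next
  show "surj (from_coordinates :: _ \<Rightarrow> 'a)"
  proof (rule surjI)
    fix x :: 'a
    show "from_coordinates (\<chi> i. representation coordinate_basis x (Rep_basis_index i)) = x"
      using sum_representation_eq[OF coordinate_basis(3)[OF assms] _ finite_coordinate_basis subset_refl]
        coordinate_basis(4)[OF assms]
      by (simp add: from_coordinates_eq Abs_basis_index_inverse)
  qed
qed

lemma DIM_coordinates:
  assumes "finite_dimensional TYPE('a::real_vector)" "\<exists>x::'a. x \<noteq> 0"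
  shows "DIM(real ^ 'a basis_index) = dim (UNIV :: 'a set)"
proof -
  have "CARD('a basis_index) = card (coordinate_basis :: 'a set)"
    by (rule bij_betw_same_card[OF bij_betw_Rep_basis_index])
  also have "\<dots> = dim (UNIV :: 'a set)"
    using dim_eq_card[of "coordinate_basis :: 'a set" UNIV] coordinate_basis(3,4)[OF assms] by simp
  finally show ?thesis by simp
qed

section \<open>Linear changes of coordinates\<close>

lemma linear_inv_bij:
  assumes "linear L" "bij L"
  shows "linear (inv L)"
proof -
  obtain g where "linear g" "g \<circ> L = id"
    using linear_injective_left_inverse[OF assms(1) bij_is_inj[OF assms(2)]] by blast
  moreover from this have "inv L y = g y" for y
    using surj_f_inv_f[OF bij_is_surj[OF assms(2)], of y] by (metis comp_apply id_apply)
  ultimately show ?thesis by (metis ext)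
qed

lemma polytope_linear_bij_image_iff:
  assumes "linear L" "bij L"
  shows "polytope (L ` S) \<longleftrightarrow> polytope S"
proof
  assume "polytope (L ` S)"
  then have "polytope (inv L ` L ` S)"
    by (rule polytope_linear_image[OF linear_inv_bij[OF assms]])
  then show "polytope S" using assms by (simp add: bij_is_inj image_inv_f_f)
qed (use assms in \<open>simp add: polytope_linear_image\<close>)

lemma unit_ball_linear_image:
  assumes "bij L"
  shows "L ` unit_ball (\<gamma> \<circ> L) = unit_ball \<gamma>"
proof -
  have "unit_ball (\<gamma> \<circ> L) = L -` unit_ball \<gamma>" by (auto simp: unit_ball_def)
  then show ?thesis using surj_image_vimage_eq[OF bij_is_surj[OF assms]] by simp
qed

lemma ft_linear_image:
  assumes "linear L" "bij L"
  shows "L ` ft (\<gamma> \<circ> L) P = ft \<gamma> (L ` P)"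
proof -
  have eq: "(\<Sum>p\<in>L ` P. \<gamma> (p - L x)) = (\<Sum>p\<in>P. (\<gamma> \<circ> L) (p - x))" for x
    using assms by (subst sum.reindex) (auto simp: bij_def linear_diff inj_on_def)
  have "L x \<in> ft \<gamma> (L ` P) \<longleftrightarrow> x \<in> ft (\<gamma> \<circ> L) P" for x
    unfolding ft_def mem_Collect_eq using eq bij_is_surj[OF assms(2)] by (metis surjD)
  then have "ft (\<gamma> \<circ> L) P = L -` ft \<gamma> (L ` P)" by auto
  then show ?thesis using surj_image_vimage_eq[OF bij_is_surj[OF assms(2)]] by simp
qed

lemma exposed_face_linear_image:
  assumes "linear L" "bij L" "exposed_face F K"
  shows "exposed_face (L ` F) (L ` K)"
proof -
  obtain \<phi> :: "'a \<Rightarrow> real" where \<phi>: "linear \<phi>" "\<phi> \<noteq> (\<lambda>_. 0)"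
      "F = K \<inter> {y. \<phi> y = (SUP x\<in>K. \<phi> x)}"
    using assms(3) by (auto simp: exposed_face_def)
  have inv: "inv L (L x) = x" for x using assms(2) by (simp add: bij_is_inj)
  have "linear (\<phi> \<circ> inv L)" using linear_inv_bij[OF assms(1,2)] \<phi>(1) by (rule linear_compose)
  moreover have "\<phi> \<circ> inv L \<noteq> (\<lambda>_. 0)" using \<phi>(2) inv by (metis comp_apply ext)
  moreover have "L ` F = L ` K \<inter> {y. (\<phi> \<circ> inv L) y = (SUP x\<in>L ` K. (\<phi> \<circ> inv L) x)}"
    unfolding \<phi>(3) by (auto simp: image_image inv)
  ultimately show ?thesis unfolding exposed_face_def by blast
qed

theorem corollary3p1:
  fixes \<gamma> :: "'a::real_vector \<Rightarrow> real"
  assumes "finite_dimensional TYPE('a)"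
    and "minkowski_gauge \<gamma>"
  shows "((\<forall>F. exposed_face F (unit_ball \<gamma>) \<longrightarrow> polytope F) \<longrightarrow>
            (\<forall>P. finite P \<and> P \<noteq> {} \<longrightarrow> polytope (ft \<gamma> P))) \<and>
         (dim (UNIV :: 'a set) = 2 \<longrightarrow>
            (\<forall>P. finite P \<and> P \<noteq> {} \<longrightarrow> polytope (ft \<gamma> P))) \<and>
         (polytope (unit_ball \<gamma>) \<longrightarrow>
            (\<forall>P. finite P \<and> P \<noteq> {} \<longrightarrow> polytope (ft \<gamma> P)))"
proof (cases "\<exists>x::'a. x \<noteq> 0")
  \<comment> \<open>The trivial space has no nonempty basis, so the coordinate space is not isomorphic to it.\<close>
  case False
  then have "(UNIV :: 'a set) = {0}" by auto
  then have "S = {} \<or> S = {0}" for S :: "'a set" by (metis subset_UNIV subset_singletonD)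
  then have "polytope S" for S :: "'a set" by (metis polytope_empty polytope_sing)
  then show ?thesis by simp
next
  case True
  define L where "L = (from_coordinates :: real ^ 'a basis_index \<Rightarrow> 'a)"
  have L: "linear L" "bij L"
    using bij_from_coordinates[OF assms(1) True] by (simp_all add: L_def linear_from_coordinates)
  have g: "minkowski_gauge (\<gamma> \<circ> L)"
    using gauge_comp_linear_inj[OF assms(2) L(1)] L(2) by (simp add: bij_is_inj)
  have ball: "L ` unit_ball (\<gamma> \<circ> L) = unit_ball \<gamma>" by (rule unit_ball_linear_image[OF L(2)])
  have *: "polytope (ft \<gamma> P)"
    if faces: "\<And>F. exposed_face F (unit_ball (\<gamma> \<circ> L)) \<Longrightarrow> polytope F" and P: "finite P" "P \<noteq> {}" for P
  proof -
    obtain Q where "P = L ` Q" "finite Q"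
      using P(1) bij_is_surj[OF L(2)] finite_subset_image[of P L UNIV] by auto
    moreover have "polytope (ft (\<gamma> \<circ> L) Q)"
      using P calculation by (intro polytope_ft_euclidean g faces) auto
    ultimately show ?thesis
      using polytope_linear_image[OF L(1)] ft_linear_image[OF L] by metis
  qed
  have "polytope F" if "\<forall>F. exposed_face F (unit_ball \<gamma>) \<longrightarrow> polytope F" "exposed_face F (unit_ball (\<gamma> \<circ> L))" for F
    using that exposed_face_linear_image[OF L that(2)]
    unfolding ball by (metis polytope_linear_bij_image_iff[OF L])
  moreover have "polytope F" if "dim (UNIV :: 'a set) = 2" "exposed_face F (unit_ball (\<gamma> \<circ> L))" for F
    using that DIM_coordinates[OF assms(1) True]
    by (intro polytope_exposed_face_plane[OF _ compact_unit_ball[OF g] convex_unit_ball[OF g]]) auto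
  moreover have "polytope F" if "polytope (unit_ball \<gamma>)" "exposed_face F (unit_ball (\<gamma> \<circ> L))" for F
    using that polytope_exposed_face_of_polytope polytope_linear_bij_image_iff[OF L, of "unit_ball (\<gamma> \<circ> L)"]
    by (simp add: ball)
  ultimately show ?thesis using * by blast
qed

end
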